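(* Let $\beta(s)=\sum_{n=1}^{+\infty}\frac{(-1)^{n-1}}{(2n-1)^s}$ for $\mathrm{Re}(s)>0$. Then $\beta(1)=\frac{\pi}{4}$, $\beta(3)=\frac{\pi^3}{32}$, $\beta(5)=\frac{5\pi^5}{1536}$, and more generally, for every positive integer $l$, $$\beta(2l-1)=\frac{(-1)^{l+1}\pi^{2l-1}}{2^{2l}}\left[\frac{1}{\Gamma(2l-1)}+2\sum_{j=1}^{l-1}\frac{(-1)^j2^{2j}\lambda(2j)}{\Gamma(2l-2j)\pi^{2j}}\right]$$ $$=\frac{(-1)^{l+1}\pi^{2l-1}}{2^{2l}}\left[\frac{1}{\Gamma(2l-1)}+2\sum_{j=1}^{l-1}\frac{(-1)^j(2^{2j}-1)\zeta(2j)}{\Gamma(2l-2j)\pi^{2j}}\right]$$ $$=\frac{(-1)^{l+1}\pi^{2l-1}}{2^{2l}}\left[\frac{1}{\Gamma(2l-1)}-\sum_{j=1}^{l-1}\frac{2^{2j}(2^{2j}-1)B_{2j}}{\Gamma(2l-2j)\Gamma(2j+1)}\right].$$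
   Context: Here $\zeta(s)=\sum_{n=1}^{+\infty}\frac{1}{n^s}$ and $\lambda(s)=\sum_{n=1}^{+\infty}\frac{1}{(2n-1)^s}$ for $\mathrm{Re}(s)>1$ (Riemann zeta function and Dirichlet lambda function), $\Gamma$ is the Gamma function, and $B_n$ is the $n$-th Bernoulli number, defined by $\frac{x}{e^x-1}=\sum_{n=0}^{+\infty}\frac{B_n}{n!}x^n$. An empty sum (such as $\sum_{j=1}^{0}$) equals $0$. *)

theory Defs
  imports "HOL-Analysis.Analysis" "HOL-Computational_Algebra.Formal_Power_Series"
begin

text \<open>The series over n = 1, 2, ... are reindexed to start at 0. The three functions are
  only meaningful where the series converge: Re s > 1 for the first two and Re s > 0 for
  the third; \<^const>\<open>suminf\<close> is unspecified elsewhere. The series for \<open>dirichlet_beta\<close> converges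
  only conditionally when Re s \<le> 1, so the ordered sum \<^const>\<open>suminf\<close> is essential.\<close>

definition zeta :: "complex \<Rightarrow> complex" where
  "zeta s = (\<Sum>n. 1 / of_nat (n + 1) powr s)"

definition dirichlet_lambda :: "complex \<Rightarrow> complex" where
  "dirichlet_lambda s = (\<Sum>n. 1 / of_nat (2 * n + 1) powr s)"

definition dirichlet_beta :: "complex \<Rightarrow> complex" where
  "dirichlet_beta s = (\<Sum>n. (-1) ^ n / of_nat (2 * n + 1) powr s)"

text \<open>The generating function x / (exp x - 1) is read as a formal power series. The quotient
  is exact although the denominator has zero constant term, see the lemma below.\<close>

definition bernoulli :: "nat \<Rightarrow> real" where
  "bernoulli n = fact n * fps_nth (fps_X / (fps_exp 1 - 1)) n"

lemma bernoulli_generating_function: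
  "Abs_fps (\<lambda>n. bernoulli n / fact n) * (fps_exp 1 - 1) = fps_X"
proof -
  have nth1: "fps_nth (fps_exp 1 - 1 :: real fps) 1 \<noteq> 0"
    by simp
  have sub: "subdegree (fps_exp 1 - 1 :: real fps) = 1"
    by (rule subdegreeI) (use nth1 in auto)
  have ne: "fps_exp 1 - 1 \<noteq> (0 :: real fps)"
    using nth1 by force
  have "(fps_exp 1 - 1 :: real fps) dvd fps_X"
    using ne sub by (subst fps_dvd_iff) auto
  moreover have "Abs_fps (\<lambda>n. bernoulli n / fact n) = fps_X / (fps_exp 1 - 1)"
    by (rule fps_ext) (simp add: bernoulli_def)
  ultimately show ?thesis
    by simp
qed

end

theory Submission
  imports Defs
begin

text \<open>Integrating the square wave \<open>\<Sum>n. sin ((2n+1)x) / (2n+1) = \<pi>/4\<close> on \<open>(0, \<pi>)\<close> repeatedly from \<open>0\<close>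
  shows that on \<open>[0, \<pi>/2]\<close> the series \<open>\<Sum>n. sin ((2n+1)x) / (2n+1)^(2l+1)\<close> and
  \<open>\<Sum>n. cos ((2n+1)x) / (2n+1)^(2l)\<close> are polynomials whose coefficients are the values \<open>\<lambda>(2j)\<close>, up to
  factorials, and \<open>\<pi>/4\<close>. At \<open>x = \<pi>/2\<close> the sine series is \<open>\<beta>(2l+1)\<close>, which gives the first formula.
  The cosine series vanishes there, which says that the \<open>\<lambda>(2j)\<close>, suitably scaled, are the
  coefficients of \<open>x tanh x\<close>; these are also known in terms of Bernoulli numbers.\<close>

section \<open>Sine and cosine series over odd frequencies, differentiated term by term\<close>

definition odd_sin_series :: "nat \<Rightarrow> real \<Rightarrow> real" where
  "odd_sin_series k x = (\<Sum>n. sin (real (2 * n + 1) * x) / real (2 * n + 1) ^ k)"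

definition odd_cos_series :: "nat \<Rightarrow> real \<Rightarrow> real" where
  "odd_cos_series k x = (\<Sum>n. cos (real (2 * n + 1) * x) / real (2 * n + 1) ^ k)"

text \<open>Real form of \<open>dirichlet_lambda\<close> at natural exponents: the analysis stays
  over the reals and is transferred to the complex functions at the end.\<close>

definition lambda_real :: "nat \<Rightarrow> real" where
  "lambda_real k = (\<Sum>n. 1 / real (2 * n + 1) ^ k)"

lemma summable_inverse_odd_power:
  assumes "k \<ge> 2"
  shows "summable (\<lambda>n. 1 / real (2 * n + 1) ^ k)"
proof (rule summable_comparison_test'[where N = 0])
  show "summable (\<lambda>n. 1 / real (Suc n) ^ k)"
    using inverse_power_summable[OF assms, where 'a = real]
    by (subst (asm) summable_Suc_iff[symmetric]) (simp add: field_simps)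
next
  fix n :: nat
  have "real (Suc n) ^ k \<le> real (2 * n + 1) ^ k"
    by (intro power_mono) auto
  then show "norm (1 / real (2 * n + 1) ^ k) \<le> 1 / real (Suc n) ^ k"
    by (simp add: field_simps del: of_nat_Suc)
qed

lemma summable_odd_trig:
  fixes g :: "real \<Rightarrow> real"
  assumes "k \<ge> 2" "\<And>x. \<bar>g x\<bar> \<le> 1"
  shows "summable (\<lambda>n. g (real (2 * n + 1) * x) / real (2 * n + 1) ^ k)"
  using assms(2) by (intro summable_comparison_test'[OF summable_inverse_odd_power[OF assms(1)]])
    (auto intro!: divide_right_mono)

lemma uniformly_convergent_odd_trig:
  fixes g :: "real \<Rightarrow> real"
  assumes "k \<ge> 2" "\<And>x. \<bar>g x\<bar> \<le> 1"
  shows "uniformly_convergent_on A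
           (\<lambda>n x. \<Sum>i<n. g (real (2 * i + 1) * x) / real (2 * i + 1) ^ k)"
  using assms(2)
  by (intro Weierstrass_m_test'[OF _ summable_inverse_odd_power[OF assms(1)]])
    (auto intro!: divide_right_mono)

text \<open>With \<open>k \<ge> 2\<close> the termwise derivatives converge uniformly by the M-test.
  Differentiating the cosine series of exponent 2 would instead produce the conditionally convergent
  square wave, so that case is handled separately below.\<close>

lemma has_field_derivative_odd_sin_series:
  assumes "k \<ge> 2"
  shows "(odd_sin_series (Suc k) has_field_derivative odd_cos_series k x) (at x)"
  unfolding odd_sin_series_def odd_cos_series_def
proof (rule has_field_derivative_series'(2)[where S = UNIV and ?x0.0 = 0
      and f = "\<lambda>n x. sin (real (2 * n + 1) * x) / real (2 * n + 1) ^ Suc k"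
      and f' = "\<lambda>n x. cos (real (2 * n + 1) * x) / real (2 * n + 1) ^ k"])
  fix n :: nat and t :: real
  show "((\<lambda>x. sin (real (2 * n + 1) * x) / real (2 * n + 1) ^ Suc k) has_field_derivative
          cos (real (2 * n + 1) * t) / real (2 * n + 1) ^ k) (at t)"
    by (auto intro!: derivative_eq_intros simp: divide_simps)
  show "uniformly_convergent_on UNIV
          (\<lambda>n x. \<Sum>i<n. cos (real (2 * i + 1) * x) / real (2 * i + 1) ^ k)"
    using assms by (intro uniformly_convergent_odd_trig) auto
qed auto

lemma has_field_derivative_odd_cos_series:
  assumes "k \<ge> 2"
  shows "(odd_cos_series (Suc k) has_field_derivative - odd_sin_series k x) (at x)"
proof -
  have eq: "(\<Sum>n. - sin (real (2 * n + 1) * x) / real (2 * n + 1) ^ k) = - odd_sin_series k x"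
    using summable_odd_trig[OF assms, of sin x]
    by (simp add: odd_sin_series_def suminf_minus)
  have "((\<lambda>x. \<Sum>n. cos (real (2 * n + 1) * x) / real (2 * n + 1) ^ Suc k) has_field_derivative
          (\<Sum>n. - sin (real (2 * n + 1) * x) / real (2 * n + 1) ^ k)) (at x)"
  proof (rule has_field_derivative_series'(2)[where S = UNIV and ?x0.0 = 0
      and f = "\<lambda>n x. cos (real (2 * n + 1) * x) / real (2 * n + 1) ^ Suc k"
      and f' = "\<lambda>n x. - sin (real (2 * n + 1) * x) / real (2 * n + 1) ^ k"])
    fix n :: nat and t :: real
    show "((\<lambda>x. cos (real (2 * n + 1) * x) / real (2 * n + 1) ^ Suc k) has_field_derivative
            - sin (real (2 * n + 1) * t) / real (2 * n + 1) ^ k) (at t)"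
      by (auto intro!: derivative_eq_intros simp: divide_simps)
    show "uniformly_convergent_on UNIV
            (\<lambda>n x. \<Sum>i<n. - sin (real (2 * i + 1) * x) / real (2 * i + 1) ^ k)"
      using assms by (intro uniformly_convergent_odd_trig[where g = "\<lambda>x. - sin x"]) auto
    show "summable (\<lambda>n. cos (real (2 * n + 1) * 0) / real (2 * n + 1) ^ Suc k)"
      using assms by (intro summable_odd_trig) auto
  qed auto
  then show ?thesis
    by (simp only: odd_cos_series_def[abs_def] eq)
qed

text \<open>A uniform limit of continuous partial sums. Continuity is what later reaches the point
  0, where the square wave estimate breaks down.\<close>

lemma continuous_on_odd_cos_series:
  assumes "k \<ge> 2"
  shows "continuous_on A (odd_cos_series k)"
proof -
  have "uniform_limit A (\<lambda>n x. \<Sum>i<n. cos (real (2 * i + 1) * x) / real (2 * i + 1) ^ k)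
          (odd_cos_series k) sequentially"
    using uniformly_convergent_odd_trig[OF assms, of cos A]
    unfolding uniformly_convergent_uniform_limit_iff
    by (simp add: odd_cos_series_def[abs_def] suminf_eq_lim[abs_def])
  then show ?thesis
    by (rule uniform_limit_theorem[rotated]) (auto intro!: always_eventually continuous_intros)
qed

lemma odd_sin_series_0 [simp]: "odd_sin_series k 0 = 0"
  by (simp add: odd_sin_series_def)

lemma odd_cos_series_0 [simp]: "odd_cos_series k 0 = lambda_real k"
  by (simp add: odd_cos_series_def lambda_real_def)

section \<open>Values at \<pi>/2 and the Leibniz series\<close>

lemma sin_odd_pi_half: "sin (real (2 * n + 1) * (pi / 2)) = (-1) ^ n"
  using sin_cos_npi[of n] by (simp add: field_simps)

lemma cos_odd_pi_half: "cos (real (2 * n + 1) * (pi / 2)) = 0"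
  using cos_zero_iff_int[of "real (2 * n + 1) * (pi / 2)"]
  by (auto intro!: exI[of _ "int (2 * n + 1)"])

lemma odd_sin_series_pi_half: "odd_sin_series k (pi / 2) = (\<Sum>n. (-1) ^ n / real (2 * n + 1) ^ k)"
  unfolding odd_sin_series_def by (simp only: sin_odd_pi_half)

lemma odd_cos_series_pi_half: "odd_cos_series k (pi / 2) = 0"
  unfolding odd_cos_series_def by (simp only: cos_odd_pi_half) simp

lemma sums_leibniz: "(\<lambda>n. (-1) ^ n / real (2 * n + 1)) sums (pi / 4)"
proof -
  \<comment> \<open>\<open>pi_series\<close> only identifies the \<open>suminf\<close>; convergence
    comes from the arctangent series at the end point 1.\<close>
  have "summable (\<lambda>n. (-1) ^ n * 1 / real (n * 2 + 1))"
    using summable_arctan_series[of 1] by (simp add: mult.commute)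
  then show ?thesis
    using pi_series by (simp add: sums_iff mult.commute)
qed

section \<open>The square wave and the cosine series of exponent 2\<close>

text \<open>Telescoping: 2 sin x cos ((2N+1)x) = sin (2(N+1)x) - sin (2Nx).\<close>

lemma sum_cos_odd:
  fixes x :: real
  shows "2 * sin x * (\<Sum>n<N. cos (real (2 * n + 1) * x)) = sin (2 * real N * x)"
proof (induction N)
  case (Suc N)
  have "2 * sin x * cos (real (2 * N + 1) * x) =
          sin (x + real (2 * N + 1) * x) + sin (x - real (2 * N + 1) * x)"
    by (simp only: sin_add sin_diff)
  also have "x + real (2 * N + 1) * x = 2 * real (Suc N) * x"
    by (simp add: algebra_simps)
  also have "x - real (2 * N + 1) * x = - (2 * real N * x)"
    by (simp add: algebra_simps)
  finally show ?case
    using Suc by (simp add: distrib_left del: of_nat_Suc)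
qed simp

text \<open>The derivative \<open>sin (2Nt) / (2 sin t)\<close> of the partial sum does not get small, but one step of
  integration by parts, which is the correction \<open>cos (2Nt) / (4N sin t)\<close> below, gains a factor
  \<open>1/N\<close> away from the zeros of the sine.\<close>

lemma square_wave_partial_sum_bound:
  fixes x t :: real
  defines "S \<equiv> \<lambda>N t. \<Sum>n<N. sin (real (2 * n + 1) * t) / real (2 * n + 1)"
  assumes x: "0 < x" "x \<le> t" "t \<le> pi / 2" and N: "N > 0"
  shows "\<bar>S N t - S N (pi / 2)\<bar> \<le> 1 / (real N * sin x ^ 2)"
proof -
  define s where "s = sin x"
  have s: "0 < s" "s \<le> 1"
    using x by (auto simp: s_def intro!: sin_gt_zero)
  have sin_ge: "s \<le> sin u" if "u \<in> {x..pi/2}" for u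
    unfolding s_def using that x by (intro sin_monotone_2pi_le) auto
  define c where "c = (\<lambda>u. cos (2 * real N * u) / (4 * real N * sin u))"
  \<comment> \<open>Derivative of \<open>S N u + c u\<close>: differentiating the numerator of
    \<open>c\<close> cancels sin (2Nu) / (2 sin u), so only the term coming from 1 / sin u
    survives.\<close>
  define c' where "c' = (\<lambda>u. - (cos (2 * real N * u) * cos u / (4 * real N * sin u ^ 2)))"
  have deriv: "((\<lambda>u. S N u + c u) has_field_derivative c' u) (at u within {x..pi/2})"
    if u: "u \<in> {x..pi/2}" for u
  proof -
    have su: "sin u > 0" using sin_ge[OF u] s by linarith
    have "((\<lambda>u. S N u) has_field_derivative (\<Sum>n<N. cos (real (2 * n + 1) * u)))
            (at u within {x..pi/2})"
      unfolding S_def by (auto intro!: derivative_eq_intros sum.cong simp: divide_simps)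
    moreover have "(\<Sum>n<N. cos (real (2 * n + 1) * u)) = sin (2 * real N * u) / (2 * sin u)"
      using sum_cos_odd[of u N] su by (simp add: field_simps)
    moreover have "(c has_field_derivative
        - (sin (2 * real N * u) / (2 * sin u)) + c' u) (at u within {x..pi/2})"
      unfolding c_def c'_def using su N
      by (auto intro!: derivative_eq_intros simp: field_simps power2_eq_square)
    ultimately show ?thesis
      by (auto dest: DERIV_add)
  qed
  have "norm (c' u) \<le> 1 / (4 * real N * s ^ 2)" if u: "u \<in> {x..pi/2}" for u
  proof -
    have "\<bar>cos (2 * real N * u) * cos u\<bar> \<le> 1 * 1"
      unfolding abs_mult by (intro mult_mono) auto
    moreover have "s ^ 2 \<le> sin u ^ 2"
      using sin_ge[OF u] s by (intro power_mono) auto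
    ultimately show ?thesis
      using s N unfolding c'_def by (auto simp: abs_mult intro!: frac_le)
  qed
  from field_differentiable_bound[OF _ deriv this, of t "pi / 2"]
  have "\<bar>S N t + c t - (S N (pi/2) + c (pi/2))\<bar> \<le> 1 / (4 * real N * s ^ 2) * \<bar>t - pi / 2\<bar>"
    using x by auto
  \<comment> \<open>Both points lie in (0, \<pi>/2], and \<pi> < 4.\<close>
  also have "\<dots> \<le> 1 / (4 * real N * s ^ 2) * 2"
    using x pi_less_4 s N by (intro mult_left_mono) auto
  finally have 1: "\<bar>S N t + c t - (S N (pi/2) + c (pi/2))\<bar> \<le> 2 / (4 * real N * s ^ 2)"
    by simp
  have "\<bar>c u\<bar> \<le> 1 / (4 * real N * s ^ 2)" if u: "u \<in> {x..pi/2}" for u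
  proof -
    have "s ^ 2 \<le> s"
      using s by (simp add: power2_eq_square mult_left_le)
    then show ?thesis
      using sin_ge[OF u] s N unfolding c_def by (auto simp: abs_mult intro!: frac_le mult_left_mono)
  qed
  from this[of t] this[of "pi / 2"]
  have "\<bar>c t\<bar> \<le> 1 / (4 * real N * s ^ 2)" "\<bar>c (pi / 2)\<bar> \<le> 1 / (4 * real N * s ^ 2)"
    using x by auto
  \<comment> \<open>Of the four quarters of 1 / (N s^2), two come from the derivative bound and one
    from the correction \<open>c\<close> at each end point.\<close>
  with 1 have "\<bar>S N t - S N (pi / 2)\<bar> \<le> 2 / (4 * real N * s ^ 2) + 2 * (1 / (4 * real N * s ^ 2))"
    by linarith
  then show ?thesis by (simp add: s_def)
qed

text \<open>The partial sums plus \<pi>t/4 have derivative \<pi>/4 - S N t, which tends to 0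
  uniformly on [x, \<pi>/2]. By the mean value bound the limit takes the same value at x as at
  \<pi>/2, where every cosine vanishes and \<pi>^2/8 remains.\<close>

lemma odd_cos_series_2_plus_linear:
  assumes "0 < x" "x \<le> pi / 2"
  shows "odd_cos_series 2 x + pi / 4 * x = pi\<^sup>2 / 8"
proof -
  define S where "S = (\<lambda>N t. \<Sum>n<N. sin (real (2 * n + 1) * t) / real (2 * n + 1))"
  define C where "C = (\<lambda>N t. \<Sum>n<N. cos (real (2 * n + 1) * t) / real (2 * n + 1) ^ 2)"
  \<comment> \<open>The first summand compares \<open>S N t\<close> with
    \<open>S N (pi / 2)\<close>, uniformly for t in [x, \<pi>/2]; the second is the error of the
    Leibniz partial sum.\<close>
  define B where "B = (\<lambda>N. 1 / (real N * sin x ^ 2) + \<bar>S N (pi / 2) - pi / 4\<bar>)"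
  have "(\<lambda>N. C N x + pi / 4 * x - pi\<^sup>2 / 8) \<longlonglongrightarrow> 0"
  proof (rule Lim_null_comparison)
    show "\<forall>\<^sub>F N in sequentially. norm (C N x + pi / 4 * x - pi\<^sup>2 / 8) \<le> B N * \<bar>x - pi / 2\<bar>"
      using eventually_gt_at_top[of 0]
    proof eventually_elim
      case (elim N)
      have deriv: "((\<lambda>t. C N t + pi / 4 * t) has_field_derivative (pi / 4 - S N t))
                      (at t within {x..pi/2})" for t
        unfolding C_def S_def
        by (auto intro!: derivative_eq_intros simp: sum_negf[symmetric] divide_simps power2_eq_square
            intro!: sum.cong)
      have bound: "norm (pi / 4 - S N t) \<le> B N" if "t \<in> {x..pi/2}" for t
        using square_wave_partial_sum_bound[of x t N] that elim assms
        unfolding B_def S_def by auto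
      have "C N (pi / 2) = 0"
        unfolding C_def by (simp only: cos_odd_pi_half) simp
      with field_differentiable_bound[OF _ deriv bound, of x "pi / 2"] assms
      show ?case by (auto simp: power2_eq_square)
    qed
    have "(\<lambda>N. S N (pi / 2)) \<longlonglongrightarrow> pi / 4"
      using sums_leibniz unfolding sums_def S_def by (simp only: sin_odd_pi_half)
    then have "(\<lambda>N. \<bar>S N (pi / 2) - pi / 4\<bar>) \<longlonglongrightarrow> 0"
      by (intro tendsto_rabs_zero) (simp add: LIM_zero)
    moreover have "(\<lambda>N. inverse (sin x ^ 2) * (1 / real N)) \<longlonglongrightarrow> 0"
      by (intro tendsto_mult_right_zero lim_1_over_n)
    ultimately have "(\<lambda>N. inverse (sin x ^ 2) * (1 / real N) + \<bar>S N (pi / 2) - pi / 4\<bar>) \<longlonglongrightarrow> 0"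
      by (rule tendsto_add_zero[rotated])
    moreover have "B = (\<lambda>N. inverse (sin x ^ 2) * (1 / real N) + \<bar>S N (pi / 2) - pi / 4\<bar>)"
      unfolding B_def by (simp only: divide_inverse inverse_mult_distrib mult_1_left mult.commute)
    ultimately have "B \<longlonglongrightarrow> 0"
      by simp
    then show "(\<lambda>N. B N * \<bar>x - pi / 2\<bar>) \<longlonglongrightarrow> 0"
      by (rule tendsto_mult_left_zero)
  qed
  then have "(\<lambda>N. C N x + pi / 4 * x - pi\<^sup>2 / 8 + (pi\<^sup>2 / 8 - pi / 4 * x))
               \<longlonglongrightarrow> 0 + (pi\<^sup>2 / 8 - pi / 4 * x)"
    by (intro tendsto_intros)
  then have "(\<lambda>N. C N x) \<longlonglongrightarrow> pi\<^sup>2 / 8 - pi / 4 * x"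
    by simp
  moreover have "(\<lambda>N. C N x) \<longlonglongrightarrow> odd_cos_series 2 x"
    using summable_LIMSEQ[OF summable_odd_trig[of 2 cos x]]
    unfolding C_def odd_cos_series_def by simp
  ultimately show ?thesis
    using LIMSEQ_unique by fastforce
qed

text \<open>Constancy on the open interval extends to its closure by continuity. Comparing the
  values at 0 and at x replaces \<pi>^2/8 by \<open>lambda_real 2\<close>.\<close>

lemma odd_cos_series_2:
  assumes "0 \<le> x" "x \<le> pi / 2"
  shows "odd_cos_series 2 x = lambda_real 2 - pi / 4 * x"
proof -
  let ?f = "\<lambda>y. odd_cos_series 2 y + pi / 4 * y"
  have closure: "closure {0<..<pi/2} = {0..pi/2}"
    by (rule closure_greaterThanLessThan) simp
  have "?f y = pi\<^sup>2 / 8" if "y \<in> {0..pi/2}" for y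
  proof (rule continuous_constant_on_closure[where f = ?f and S = "{0<..<pi/2}"])
    show "continuous_on (closure {0<..<pi/2}) ?f"
      by (intro continuous_intros continuous_on_odd_cos_series) simp
    show "?f t = pi\<^sup>2 / 8" if "t \<in> {0<..<pi/2}" for t
      using that by (intro odd_cos_series_2_plus_linear) simp_all
  qed (use that closure in simp)
  from this[of 0] this[of x] show ?thesis
    using assms by auto
qed

section \<open>Polynomial forms on [0, \<pi>/2] by repeated integration\<close>

text \<open>Stands in for integration from \<open>a\<close>: antiderivatives of the same function
  with the same initial value coincide.\<close>

lemma eq_of_has_field_derivative_eq:
  fixes f g :: "real \<Rightarrow> real"
  assumes "\<And>t. t \<in> {a..b} \<Longrightarrow> (f has_field_derivative f' t) (at t)"
    and "\<And>t. t \<in> {a..b} \<Longrightarrow> (g has_field_derivative f' t) (at t)"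
    and "f a = g a" "x \<in> {a..b}"
  shows "f x = g x"
proof -
  have "((\<lambda>t. f t - g t) has_field_derivative 0) (at t within {a..b})" if "t \<in> {a..b}" for t
    using DERIV_diff[OF assms(1,2)[OF that]] by (auto intro: has_field_derivative_at_within)
  then obtain c where "\<forall>t\<in>{a..b}. f t - g t = c"
    using has_field_derivative_zero_constant[of "{a..b}" "\<lambda>t. f t - g t"] by auto
  then have "f x - g x = c" "f a - g a = c"
    using assms(4) by auto
  with assms(3) show ?thesis by simp
qed

lemma DERIV_power_over_fact:
  "((\<lambda>x. x ^ Suc n / fact (Suc n)) has_field_derivative (x ^ n / fact n)) (at (x :: real))"
proof -
  have "((\<lambda>x. x ^ Suc n) has_field_derivative (real (Suc n) * x ^ n)) (at x)"
    using DERIV_pow[of "Suc n" x UNIV] by simp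
  from DERIV_cdivide[OF this, of "fact (Suc n)"] show ?thesis
    by (simp add: divide_simps del: of_nat_Suc)
qed

text \<open>The Taylor polynomial at 0 from the right: derivatives of even order below 2l give the
  values \<lambda>(2(l-i)) with alternating signs, those of odd order below 2l-1 vanish, and the
  last term stems from the square wave value \<pi>/4. Meant for \<open>l \<ge> 1\<close>, since
  \<open>2 * l - 1\<close> truncates at \<open>l = 0\<close>.\<close>

definition odd_cos_poly :: "nat \<Rightarrow> real \<Rightarrow> real" where
  "odd_cos_poly l x = (\<Sum>i<l. (-1) ^ i * lambda_real (2 * (l - i)) * (x ^ (2 * i) / fact (2 * i)))
     + (-1) ^ l * (pi / 4) * (x ^ (2 * l - 1) / fact (2 * l - 1))"

text \<open>For \<open>l \<ge> 1\<close> this is the antiderivative of \<open>odd_cos_poly l\<close>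
  vanishing at 0; for \<open>l = 0\<close> it is the constant \<pi>/4, the square wave
  itself.\<close>

definition odd_sin_poly :: "nat \<Rightarrow> real \<Rightarrow> real" where
  "odd_sin_poly l x =
     (\<Sum>i<l. (-1) ^ i * lambda_real (2 * (l - i)) * (x ^ Suc (2 * i) / fact (Suc (2 * i))))
     + (-1) ^ l * (pi / 4) * (x ^ (2 * l) / fact (2 * l))"

lemma DERIV_odd_sin_poly:
  assumes "l \<ge> 1"
  shows "(odd_sin_poly l has_field_derivative odd_cos_poly l x) (at x)"
proof -
  have "((\<lambda>x. x ^ (2 * l) / fact (2 * l)) has_field_derivative
          (x ^ (2 * l - 1) / fact (2 * l - 1))) (at x)"
    using DERIV_power_over_fact[of "2 * l - 1" x] assms by (cases l) simp_all
  then show ?thesis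
    unfolding odd_sin_poly_def[abs_def] odd_cos_poly_def
    by (intro DERIV_add DERIV_sum DERIV_cmult DERIV_power_over_fact)
qed

text \<open>Splits off the constant term, so that every remaining monomial has a positive exponent
  and can be differentiated by \<open>DERIV_power_over_fact\<close>.\<close>

lemma odd_cos_poly_Suc:
  "odd_cos_poly (Suc l) x = lambda_real (2 * Suc l)
     - (\<Sum>i<l. (-1) ^ i * lambda_real (2 * (l - i)) * (x ^ Suc (Suc (2 * i)) / fact (Suc (Suc (2 * i)))))
     - (-1) ^ l * (pi / 4) * (x ^ Suc (2 * l) / fact (Suc (2 * l)))"
  unfolding odd_cos_poly_def sum.lessThan_Suc_shift
  by (simp add: sum_negf[symmetric])

lemma DERIV_odd_cos_poly:
  "(odd_cos_poly (Suc l) has_field_derivative - odd_sin_poly l x) (at x)"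
proof -
  have "((\<lambda>x. lambda_real (2 * Suc l)
      - (\<Sum>i<l. (-1) ^ i * lambda_real (2 * (l - i)) * (x ^ Suc (Suc (2 * i)) / fact (Suc (Suc (2 * i)))))
      - (-1) ^ l * (pi / 4) * (x ^ Suc (2 * l) / fact (Suc (2 * l)))) has_field_derivative
      (0 - (\<Sum>i<l. (-1) ^ i * lambda_real (2 * (l - i)) * (x ^ Suc (2 * i) / fact (Suc (2 * i))))
      - (-1) ^ l * (pi / 4) * (x ^ (2 * l) / fact (2 * l)))) (at x)"
    by (intro DERIV_diff DERIV_sum DERIV_cmult DERIV_power_over_fact DERIV_const)
  then show ?thesis
    unfolding odd_cos_poly_Suc[abs_def] odd_sin_poly_def
    by (simp only: diff_0 minus_add_distrib diff_conv_add_uminus add_0)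
qed

text \<open>Induction climbing from the cosine series of exponent 2l to the sine series of exponent
  2l+1 and on to the cosine series of exponent 2l+2. Each step matches derivatives and the value at
  0.\<close>

lemma odd_trig_series_eq_poly:
  assumes "l \<ge> 1"
  shows "x \<in> {0..pi/2} \<Longrightarrow> odd_cos_series (2 * l) x = odd_cos_poly l x"
    and "x \<in> {0..pi/2} \<Longrightarrow> odd_sin_series (2 * l + 1) x = odd_sin_poly l x"
proof -
  \<comment> \<open>Stated for arbitrary \<open>l\<close>, as it serves both inside the induction
    and for the second claim.\<close>
  have sin_step: "odd_sin_series (2 * l + 1) x = odd_sin_poly l x"
    if l: "l \<ge> 1" and cos: "\<And>x. x \<in> {0..pi/2} \<Longrightarrow> odd_cos_series (2 * l) x = odd_cos_poly l x"
      and x: "x \<in> {0..pi/2}" for l x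
  proof (rule eq_of_has_field_derivative_eq[where a = 0 and b = "pi / 2"
      and f = "odd_sin_series (2 * l + 1)" and g = "odd_sin_poly l" and f' = "odd_cos_poly l"])
    fix t assume t: "t \<in> {0..pi/2}"
    show "(odd_sin_series (2 * l + 1) has_field_derivative odd_cos_poly l t) (at t)"
      using has_field_derivative_odd_sin_series[of "2 * l" t] l cos[OF t] by simp
    show "(odd_sin_poly l has_field_derivative odd_cos_poly l t) (at t)"
      using l by (rule DERIV_odd_sin_poly)
  next
    show "odd_sin_series (2 * l + 1) 0 = odd_sin_poly l 0"
      using l by (simp add: odd_sin_poly_def)
  qed (rule x)
  have "\<forall>x\<in>{0..pi/2}. odd_cos_series (2 * l) x = odd_cos_poly l x"
    using assms
  proof (induction l rule: dec_induct)
    case base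
    show ?case by (auto simp: odd_cos_series_2 odd_cos_poly_def)
  next
    case (step l)
    show ?case
    proof
      fix x assume x: "x \<in> {0..pi/2}"
      show "odd_cos_series (2 * Suc l) x = odd_cos_poly (Suc l) x"
      proof (rule eq_of_has_field_derivative_eq[where a = 0 and b = "pi / 2"
          and f = "odd_cos_series (2 * Suc l)" and g = "odd_cos_poly (Suc l)"
          and f' = "\<lambda>t. - odd_sin_poly l t"])
        fix t assume t: "t \<in> {0..pi/2}"
        have "odd_sin_series (2 * l + 1) t = odd_sin_poly l t"
          using step t by (intro sin_step) auto
        then show "(odd_cos_series (2 * Suc l) has_field_derivative - odd_sin_poly l t) (at t)"
          using has_field_derivative_odd_cos_series[of "2 * l + 1" t] step(1) by simp
        show "(odd_cos_poly (Suc l) has_field_derivative - odd_sin_poly l t) (at t)"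
          by (rule DERIV_odd_cos_poly)
      next
        show "odd_cos_series (2 * Suc l) 0 = odd_cos_poly (Suc l) 0"
          by (simp add: odd_cos_poly_Suc)
      qed (rule x)
    qed
  qed
  then show cos: "x \<in> {0..pi/2} \<Longrightarrow> odd_cos_series (2 * l) x = odd_cos_poly l x" for x
    by blast
  show "x \<in> {0..pi/2} \<Longrightarrow> odd_sin_series (2 * l + 1) x = odd_sin_poly l x"
    using sin_step[OF assms cos] .
qed

lemma suminf_beta_eq_poly: "(\<Sum>n. (-1) ^ n / real (2 * n + 1) ^ (2 * m + 1)) = odd_sin_poly m (pi / 2)"
\<comment> \<open>For \<open>m = 0\<close> the series converges only conditionally and is Leibniz's;
  otherwise it is the sine series at \<pi>/2.\<close>
proof (cases "m = 0")
  case True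
  with sums_unique[OF sums_leibniz] show ?thesis
    by (simp add: odd_sin_poly_def)
next
  case False
  then show ?thesis
    using odd_trig_series_eq_poly(2)[of m "pi / 2"] odd_sin_series_pi_half[of "2 * m + 1"] by simp
qed

text \<open>The cosine series vanishes at \<pi>/2. Read in \<open>l\<close>, this is a linear
  recurrence for the values \<open>lambda_real (2 * j)\<close>.\<close>

lemma odd_cos_poly_pi_half:
  assumes "l \<ge> 1"
  shows "odd_cos_poly l (pi / 2) = 0"
  using odd_trig_series_eq_poly(1)[OF assms, of "pi / 2"] odd_cos_series_pi_half[of "2 * l"] by simp

section \<open>The coefficients of x tanh x and the Bernoulli numbers\<close>

text \<open>Convolution with the coefficients 1 / (2i)! of cosh is a triangular system with unit
  diagonal, so it can be cancelled by strong induction.\<close>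

lemma eq_of_cosh_convolution_eq:
  fixes u v :: "nat \<Rightarrow> real"
  assumes "\<And>l. (\<Sum>i\<le>l. u (l - i) / fact (2 * i)) = (\<Sum>i\<le>l. v (l - i) / fact (2 * i))"
  shows "u l = v l"
proof (induction l rule: less_induct)
  case (less l)
  have *: "(\<Sum>i<l. u (l - Suc i) / fact (2 * Suc i)) = (\<Sum>i<l. v (l - Suc i) / fact (2 * Suc i))"
  proof (rule sum.cong[OF refl])
    fix i assume "i \<in> {..<l}"
    then have "l - Suc i < l" by simp
    then have "u (l - Suc i) = v (l - Suc i)"
      by (rule less.IH)
    then show "u (l - Suc i) / fact (2 * Suc i) = v (l - Suc i) / fact (2 * Suc i)"
      by (simp only:)
  qed
  have "u (l - 0) / fact (2 * 0) = v (l - 0) / fact (2 * 0)"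
    using assms[of l] unfolding sum.atMost_shift * by (simp only: add_right_cancel)
  then show ?case by simp
qed

text \<open>Coefficient of x^(2j) in x tanh x, as read off from the partial fraction expansion. The
  case \<open>j = 0\<close> is separate because the series for \<open>lambda_real 0\<close>
  diverges.\<close>

definition tanh_coeff_lambda :: "nat \<Rightarrow> real" where
  "tanh_coeff_lambda j = (if j = 0 then 0 else - 2 * (-1) ^ j * lambda_real (2 * j) * (2 / pi) ^ (2 * j))"

definition tanh_coeff_bernoulli :: "nat \<Rightarrow> real" where
  "tanh_coeff_bernoulli j = 2 ^ (2 * j) * (2 ^ (2 * j) - 1) * bernoulli (2 * j) / fact (2 * j)"

text \<open>A rescaling of \<open>odd_cos_poly_pi_half\<close>. The right-hand side is the
  coefficient of x^(2l) in x sinh x = cosh x * (x tanh x).\<close>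

lemma tanh_coeff_lambda_convolution:
  "(\<Sum>i\<le>l. tanh_coeff_lambda (l - i) / fact (2 * i)) = (if l = 0 then 0 else 1 / fact (2 * l - 1))"
proof (cases "l = 0")
  case False
  \<comment> \<open>Scaling by \<open>c\<close> turns (-1)^i (\<pi>/2)^(2i) into (-1)^(l-i)
    (2/\<pi>)^(2(l-i)).\<close>
  define c where "c = (-1) ^ l * (2 / pi) ^ (2 * l)"
  have "tanh_coeff_lambda (l - i) / fact (2 * i)
          = - 2 * c * ((-1) ^ i * lambda_real (2 * (l - i)) * ((pi / 2) ^ (2 * i) / fact (2 * i)))"
    if i: "i < l" for i
  proof -
    obtain d where l: "l = i + d"
      using le_Suc_ex[OF less_imp_le[OF i]] by auto
    have "(-1 :: real) ^ i * (-1) ^ i = 1"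
      by simp
    then show ?thesis
      using i unfolding l tanh_coeff_lambda_def c_def
      by (simp add: power_add power_divide distrib_left)
  qed
  then have "(\<Sum>i<l. tanh_coeff_lambda (l - i) / fact (2 * i))
      = - 2 * c * (\<Sum>i<l. (-1) ^ i * lambda_real (2 * (l - i)) * ((pi / 2) ^ (2 * i) / fact (2 * i)))"
    unfolding sum_distrib_left by (intro sum.cong) auto
  also have "(\<Sum>i<l. (-1) ^ i * lambda_real (2 * (l - i)) * ((pi / 2) ^ (2 * i) / fact (2 * i)))
      = - ((-1) ^ l * (pi / 4) * ((pi / 2) ^ (2 * l - 1) / fact (2 * l - 1)))"
    using odd_cos_poly_pi_half[of l] False unfolding odd_cos_poly_def by simp
  also have "- 2 * c * \<dots> = ((-1) ^ l * (-1) ^ l) * ((2 / pi) ^ (2 * l) * (pi / 2 * (pi / 2) ^ (2 * l - 1)))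
      / fact (2 * l - 1)"
    by (simp add: c_def)
  also have "pi / 2 * (pi / 2) ^ (2 * l - 1) = (pi / 2) ^ (2 * l)"
    using False by (cases l) simp_all
  also have "(2 / pi) ^ (2 * l) * (pi / 2) ^ (2 * l) = 1"
    by (simp flip: power_mult_distrib)
  also have "(-1 :: real) ^ l * (-1) ^ l = 1"
    by (simp flip: power_mult_distrib)
  finally have "(\<Sum>i<l. tanh_coeff_lambda (l - i) / fact (2 * i)) = 1 / fact (2 * l - 1)"
    by simp
  \<comment> \<open>The added term \<open>i = l\<close> contributes
    \<open>tanh_coeff_lambda 0\<close>, which is 0.\<close>
  moreover have "{..l} = insert l {..<l}"
    by auto
  ultimately show ?thesis
    using False by (simp add: tanh_coeff_lambda_def)
qed (simp add: tanh_coeff_lambda_def)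

lemma sum_upto_double_even:
  fixes f :: "nat \<Rightarrow> 'a :: comm_monoid_add"
  assumes "\<And>i. odd i \<Longrightarrow> f i = 0"
  shows "(\<Sum>i=0..2*l. f i) = (\<Sum>i\<le>l. f (2 * i))"
  by (induction l) (simp_all add: assms)

text \<open>\<open>x tanh x = x + B(4x) - B(2x)\<close> where \<open>B(x) = x / (exp x - 1)\<close>.\<close>

lemma bernoulli_tanh:
  defines "W \<equiv> fps_X + Abs_fps (\<lambda>n. (4 ^ n - 2 ^ n) * bernoulli n / fact n)"
  shows "(fps_exp 1 + fps_exp (-1)) * W = fps_X * (fps_exp 1 - fps_exp (-1))"
proof -
  define B where "B = Abs_fps (\<lambda>n. bernoulli n / fact n)"
  \<comment> \<open>The series B(cx), obtained by composition.\<close>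
  define Bc where "Bc = (\<lambda>c. B oo (fps_const c * fps_X))"
  have Bc_nth: "fps_nth (Bc c) n = c ^ n * bernoulli n / fact n" for c n
    by (simp add: Bc_def B_def fps_compose_linear)
  have Bc: "Bc c * (fps_exp c - 1) = fps_const c * fps_X" for c
  proof -
    have "(B * (fps_exp 1 - 1)) oo (fps_const c * fps_X) = fps_X oo (fps_const c * fps_X)"
      using bernoulli_generating_function by (simp add: B_def)
    then show ?thesis
      by (simp add: Bc_def fps_compose_mult_distrib fps_compose_sub_distrib)
  qed
  have W: "W = fps_X + Bc 4 - Bc 2"
    by (rule fps_ext) (simp add: W_def Bc_nth algebra_simps diff_divide_distrib)
  define E where "E = (fps_exp 2 :: real fps)"
  have E4: "fps_exp 4 = E * E"
    using fps_exp_add_mult[of 2 "2 :: real"] by (simp add: E_def)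
  have "fps_nth E 1 \<noteq> fps_nth 1 1"
    by (simp add: E_def)
  then have E1: "E - 1 \<noteq> 0"
    by auto
  have c: "fps_const 2 = (2 :: real fps)" "fps_const 4 = (4 :: real fps)"
    by (simp_all add: numeral_fps_const)
  have b2: "Bc 2 * (E - 1) = 2 * fps_X" and b4: "Bc 4 * (E * E - 1) = 4 * fps_X"
    using Bc[of 2] Bc[of 4] by (simp_all add: E_def[symmetric] E4 c)
  \<comment> \<open>With E = exp (2x), the extra factor E - 1 clears both denominators E - 1 and E^2
    - 1; it is cancelled afterwards.\<close>
  have "(E - 1) * ((E + 1) * W) = (E * E - 1) * fps_X + Bc 4 * (E * E - 1) - Bc 2 * (E - 1) * (E + 1)"
    by (simp add: W algebra_simps)
  also have "\<dots> = (E - 1) * (fps_X * (E - 1))"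
    unfolding b2 b4 by (simp add: algebra_simps)
  finally have *: "(E + 1) * W = fps_X * (E - 1)"
    using E1 by simp
  \<comment> \<open>Multiplying by exp (-x) turns E + 1 and E - 1 into the symmetric sum and
    difference of exp x and exp (-x).\<close>
  have Em: "E * fps_exp (-1) = fps_exp 1"
    using fps_exp_add_mult[of 2 "-1 :: real"] by (simp add: E_def)
  have "(E * fps_exp (-1) + fps_exp (-1)) * W = fps_X * (E * fps_exp (-1) - fps_exp (-1))"
    using arg_cong[OF *, of "\<lambda>f. fps_exp (-1) * f"] by (simp add: algebra_simps)
  then show ?thesis by (simp only: Em)
qed

text \<open>Compares the coefficients of x^(2l) on both sides of \<open>bernoulli_tanh\<close>,
  which is 2 cosh x * (x tanh x) = 2 x sinh x.\<close>

lemma tanh_coeff_bernoulli_convolution: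
  "(\<Sum>i\<le>l. tanh_coeff_bernoulli (l - i) / fact (2 * i)) = (if l = 0 then 0 else 1 / fact (2 * l - 1))"
proof -
  define W where "W = fps_X + Abs_fps (\<lambda>n. (4 ^ n - 2 ^ n) * bernoulli n / fact n)"
  have W: "fps_nth W (2 * j) = tanh_coeff_bernoulli j" for j
  proof -
    have "(4 :: real) ^ (2 * j) = 2 ^ (2 * j) * 2 ^ (2 * j)"
      by (simp flip: power_mult_distrib)
    moreover have "fps_nth fps_X (2 * j) = (0 :: real)"
      by (simp add: fps_X_def)
    ultimately show ?thesis
      by (simp add: W_def tanh_coeff_bernoulli_def algebra_simps)
  qed
  have "fps_nth ((fps_exp 1 + fps_exp (-1)) * W) (2 * l)
          = (\<Sum>i=0..2*l. (1 + (-1) ^ i) / fact i * fps_nth W (2 * l - i))"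
    by (simp add: fps_mult_nth add_divide_distrib)
  \<comment> \<open>The factor 1 + (-1)^i removes all odd i, so only even coefficients of
    \<open>W\<close> remain.\<close>
  also have "\<dots> = (\<Sum>i\<le>l. (1 + (-1) ^ (2 * i)) / fact (2 * i) * fps_nth W (2 * l - 2 * i))"
    by (rule sum_upto_double_even) simp
  also have "\<dots> = 2 * (\<Sum>i\<le>l. tanh_coeff_bernoulli (l - i) / fact (2 * i))"
    unfolding sum_distrib_left by (intro sum.cong) (auto simp flip: W simp: diff_mult_distrib2)
  finally have "2 * (\<Sum>i\<le>l. tanh_coeff_bernoulli (l - i) / fact (2 * i))
      = fps_nth (fps_X * (fps_exp 1 - fps_exp (-1))) (2 * l)"
    unfolding W_def bernoulli_tanh by simp
  also have "\<dots> = (if l = 0 then 0 else 2 / fact (2 * l - 1))"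
    by auto
  finally show ?thesis
    by (simp split: if_splits)
qed

text \<open>Both sequences solve the same triangular system. For \<open>j \<ge> 1\<close> this is
  Euler's evaluation of \<zeta>(2j) in disguise.\<close>

lemma tanh_coeff_eq: "tanh_coeff_lambda j = tanh_coeff_bernoulli j"
  by (rule eq_of_cosh_convolution_eq)
    (simp only: tanh_coeff_lambda_convolution tanh_coeff_bernoulli_convolution)

section \<open>Closed form at \<pi>/2 and the first values\<close>

text \<open>Reindexing by j = m - i makes the argument of \<lambda> the summation variable. The
  prefactor is the desired one with l = m + 1.\<close>

lemma odd_sin_poly_pi_half:
  "odd_sin_poly m (pi / 2) = (-1) ^ m * pi ^ (2 * m + 1) / 2 ^ (2 * m + 2) *
     (1 / fact (2 * m) + 2 * (\<Sum>j=1..m. (-1) ^ j * 2 ^ (2 * j) * lambda_real (2 * j) /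
        (fact (2 * (m - j) + 1) * pi ^ (2 * j))))"
proof -
  define c where "c = (-1) ^ m * pi ^ (2 * m + 1) / 2 ^ (2 * m + 2)"
  have "(\<Sum>i<m. (-1) ^ i * lambda_real (2 * (m - i)) * ((pi / 2) ^ Suc (2 * i) / fact (Suc (2 * i))))
      = (\<Sum>j=1..m. (-1) ^ (m - j) * lambda_real (2 * j) *
          ((pi / 2) ^ Suc (2 * (m - j)) / fact (Suc (2 * (m - j)))))"
    by (rule sum.reindex_bij_witness[of _ "\<lambda>j. m - j" "\<lambda>i. m - i"]) auto
  also have "\<dots> = (\<Sum>j=1..m. c * (2 * ((-1) ^ j * 2 ^ (2 * j) * lambda_real (2 * j) /
        (fact (2 * (m - j) + 1) * pi ^ (2 * j)))))"
  proof (intro sum.cong refl)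
    fix j assume j: "j \<in> {1..m}"
    then obtain d where m: "m = j + d"
      using le_Suc_ex[of j m] by auto
    have "(-1 :: real) ^ j * (-1) ^ j = 1"
      by (simp flip: power_mult_distrib)
    then show "(-1) ^ (m - j) * lambda_real (2 * j) * ((pi / 2) ^ Suc (2 * (m - j)) / fact (Suc (2 * (m - j))))
      = c * (2 * ((-1) ^ j * 2 ^ (2 * j) * lambda_real (2 * j) / (fact (2 * (m - j) + 1) * pi ^ (2 * j))))"
      unfolding c_def m by (simp add: power_add power_divide distrib_left mult_ac del: fact_Suc)
  qed
  finally have "odd_sin_poly m (pi / 2) = c * (2 * (\<Sum>j=1..m. (-1) ^ j * 2 ^ (2 * j) * lambda_real (2 * j) /
        (fact (2 * (m - j) + 1) * pi ^ (2 * j)))) + (-1) ^ m * (pi / 4) * ((pi / 2) ^ (2 * m) / fact (2 * m))"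
    by (simp add: odd_sin_poly_def sum_distrib_left)
  also have "(-1) ^ m * (pi / 4) * ((pi / 2) ^ (2 * m) / fact (2 * m)) = c * (1 / fact (2 * m))"
    by (simp add: c_def power_divide)
  finally show ?thesis
    by (simp add: c_def algebra_simps)
qed

text \<open>First case of the recurrence; with the next one it supplies the values needed for
  \<beta>(3) and \<beta>(5).\<close>

lemma lambda_real_2: "lambda_real 2 = pi ^ 2 / 8"
  using odd_cos_poly_pi_half[of 1] by (simp add: odd_cos_poly_def power2_eq_square)

lemma lambda_real_4: "lambda_real 4 = pi ^ 4 / 96"
proof -
  have "lambda_real 4 - pi ^ 2 / 8 * ((pi / 2) ^ 2 / 2) + pi / 4 * ((pi / 2) ^ 3 / 6) = 0"
    using odd_cos_poly_pi_half[of 2]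
    by (simp add: odd_cos_poly_def lambda_real_2 fact_numeral lessThan_nat_numeral
        power_divide power2_eq_square power3_eq_cube power4_eq_xxxx)
  then show ?thesis
    by (simp add: power_divide power2_eq_square power3_eq_cube power4_eq_xxxx)
qed

lemma suminf_beta_3: "(\<Sum>n. (-1) ^ n / real (2 * n + 1) ^ 3) = pi ^ 3 / 32"
proof -
  have "odd_sin_poly 1 (pi / 2) = pi ^ 2 / 8 * (pi / 2) - pi / 4 * ((pi / 2) ^ 2 / 2)"
    by (simp add: odd_sin_poly_def lambda_real_2 fact_numeral)
  also have "\<dots> = pi ^ 3 / 32"
    by (simp add: power_divide power2_eq_square power3_eq_cube power4_eq_xxxx)
  finally show ?thesis
    using suminf_beta_eq_poly[of 1] by simp
qed

lemma suminf_beta_5: "(\<Sum>n. (-1) ^ n / real (2 * n + 1) ^ 5) = 5 * pi ^ 5 / 1536"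
proof -
  have "odd_sin_poly 2 (pi / 2) = pi ^ 4 / 96 * (pi / 2) - pi ^ 2 / 8 * ((pi / 2) ^ 3 / 6)
          + pi / 4 * ((pi / 2) ^ 4 / 24)"
    by (simp add: odd_sin_poly_def lambda_real_2 lambda_real_4 fact_numeral lessThan_nat_numeral
        power_divide power2_eq_square power3_eq_cube power4_eq_xxxx)
  also have "\<dots> = 5 * pi ^ 5 / 1536"
    by (simp add: power_divide eval_nat_numeral)
  finally show ?thesis
    using suminf_beta_eq_poly[of 2] by simp
qed

section \<open>Transfer to the complex functions and the final formulas\<close>

text \<open>Moving \<open>of_real\<close> through the sum requires convergence: Leibniz for
  \<open>k = 1\<close>, absolute convergence for \<open>k \<ge> 2\<close>; oddness excludes
  \<open>k = 0\<close>.\<close>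

lemma dirichlet_beta_of_nat:
  assumes "odd k"
  shows "dirichlet_beta (of_nat k) = of_real (\<Sum>n. (-1) ^ n / real (2 * n + 1) ^ k)"
proof -
  have "summable (\<lambda>n. (-1) ^ n / real (2 * n + 1) ^ k)"
  proof (cases "k = 1")
    case True
    then show ?thesis using sums_leibniz by (simp add: sums_iff)
  next
    case False
    with assms have "k \<ge> 2" by presburger
    from summable_odd_trig[OF this, of sin "pi / 2"] show ?thesis
      by (simp only: sin_odd_pi_half) simp
  qed
  then have "of_real (\<Sum>n. (-1) ^ n / real (2 * n + 1) ^ k)
      = (\<Sum>n. of_real ((-1) ^ n / real (2 * n + 1) ^ k) :: complex)"
    by (rule suminf_of_real)
  also have "(\<lambda>n. of_real ((-1) ^ n / real (2 * n + 1) ^ k) :: complex)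
      = (\<lambda>n. (-1) ^ n / of_nat (2 * n + 1) powr of_nat k)"
    by (subst powr_nat') (simp_all del: of_nat_Suc of_nat_add)
  finally show ?thesis
    by (simp add: dirichlet_beta_def)
qed

lemma dirichlet_lambda_of_nat:
  assumes "k \<ge> 2"
  shows "dirichlet_lambda (of_nat k) = of_real (lambda_real k)"
proof -
  have "of_real (lambda_real k) = (\<Sum>n. of_real (1 / real (2 * n + 1) ^ k) :: complex)"
    unfolding lambda_real_def by (rule suminf_of_real[OF summable_inverse_odd_power[OF assms]])
  also have "(\<lambda>n. of_real (1 / real (2 * n + 1) ^ k) :: complex)
      = (\<lambda>n. 1 / of_nat (2 * n + 1) powr of_nat k)"
    by (subst powr_nat') (simp_all del: of_nat_Suc of_nat_add)
  finally show ?thesis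
    by (simp add: dirichlet_lambda_def)
qed

text \<open>Grouping the zeta series in pairs separates odd from even denominators; the even ones
  sum to 2^(-k) \<zeta>(k).\<close>

lemma dirichlet_lambda_eq_zeta:
  assumes "k \<ge> 2"
  shows "2 ^ k * dirichlet_lambda (of_nat k) = (2 ^ k - 1) * zeta (of_nat k)"
proof -
  define a where "a = (\<lambda>n. 1 / (of_nat (n + 1) :: complex) ^ k)"
  have pow: "(of_nat (Suc n) :: complex) powr of_nat k = of_nat (Suc n) ^ k" for n
    by (rule powr_nat') (simp del: of_nat_Suc)
  have zeta: "zeta (of_nat k) = suminf a"
    unfolding zeta_def a_def using pow by simp
  have lambda: "dirichlet_lambda (of_nat k) = (\<Sum>n. a (2 * n))"
    unfolding dirichlet_lambda_def a_def using pow[of "2 * _"] by simp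
  have "summable (\<lambda>n. inverse (of_nat n ^ k) :: complex)"
    by (rule inverse_power_summable[OF assms])
  then have sm: "summable a"
    by (subst (asm) summable_Suc_iff[symmetric]) (simp add: a_def field_simps)
  have "(\<lambda>n. sum a {n * 2..<n * 2 + 2}) sums suminf a"
    by (rule sums_group[OF summable_sums[OF sm]]) simp
  moreover have "sum a {n * 2..<n * 2 + 2} = a (2 * n) + a n / 2 ^ k" for n
  proof -
    \<comment> \<open>Indices start at 0, so odd indices carry the even denominators 2n + 2 = 2(n +
      1).\<close>
    have "a (2 * n + 1) = a n / 2 ^ k"
      by (simp add: a_def flip: power_mult_distrib) (simp add: algebra_simps)
    moreover have "{n * 2..<n * 2 + 2} = {2 * n, 2 * n + 1}"
      by auto
    ultimately show ?thesis by simp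
  qed
  ultimately have "(\<lambda>n. a (2 * n) + a n / 2 ^ k) sums suminf a"
    by simp
  from sums_diff[OF this sums_divide[OF summable_sums[OF sm], of "2 ^ k"]]
  have "(\<lambda>n. a (2 * n)) sums (suminf a - suminf a / 2 ^ k)"
    by simp
  then have "dirichlet_lambda (of_nat k) = suminf a - suminf a / 2 ^ k"
    by (simp add: lambda sums_iff)
  then show ?thesis
    by (simp add: zeta field_simps)
qed

lemma Gamma_of_nat_Suc: "Gamma (of_nat (Suc n) :: complex) = fact n"
  using Gamma_fact[of n, where 'a = complex] by simp

lemma dirichlet_beta_eq_lambda_sum:
  assumes "l \<ge> 1"
  shows "dirichlet_beta (of_nat (2 * l - 1)) =
        (-1) ^ (l + 1) * of_real pi ^ (2 * l - 1) / 2 ^ (2 * l) *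
          (1 / Gamma (of_nat (2 * l - 1)) +
           2 * (\<Sum>j = 1..l - 1. (-1) ^ j * 2 ^ (2 * j) * dirichlet_lambda (of_nat (2 * j)) /
                  (Gamma (of_nat (2 * l - 2 * j)) * of_real pi ^ (2 * j))))"
proof -
  obtain m where l: "l = Suc m"
    using assms by (cases l) auto
  have "dirichlet_beta (of_nat (2 * m + 1)) = of_real (odd_sin_poly m (pi / 2))"
    by (subst dirichlet_beta_of_nat) (simp_all only: suminf_beta_eq_poly, simp)
  also have "\<dots> = (-1) ^ m * of_real pi ^ (2 * m + 1) / 2 ^ (2 * m + 2) *
     (1 / fact (2 * m) + 2 * (\<Sum>j=1..m. (-1) ^ j * 2 ^ (2 * j) * of_real (lambda_real (2 * j)) /
        (fact (2 * (m - j) + 1) * of_real pi ^ (2 * j))))"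
    unfolding odd_sin_poly_pi_half by (simp del: fact_Suc)
  also have "(\<Sum>j=1..m. (-1) ^ j * 2 ^ (2 * j) * of_real (lambda_real (2 * j)) /
        (fact (2 * (m - j) + 1) * of_real pi ^ (2 * j))) =
      (\<Sum>j=1..m. (-1) ^ j * 2 ^ (2 * j) * dirichlet_lambda (of_nat (2 * j)) /
        (Gamma (of_nat (2 * l - 2 * j)) * of_real pi ^ (2 * j)))"
  proof (intro sum.cong refl)
    fix j assume j: "j \<in> {1..m}"
    \<comment> \<open>From j \<le> m the natural subtraction is exact, and \<Gamma>(n+1) = n!
      applies with n = 2(m-j) + 1.\<close>
    then have "2 * l - 2 * j = Suc (2 * (m - j) + 1)"
      by (auto simp: l)
    then have "Gamma (of_nat (2 * l - 2 * j) :: complex) = fact (2 * (m - j) + 1)"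
      by (simp only: Gamma_of_nat_Suc)
    moreover have "dirichlet_lambda (of_nat (2 * j)) = of_real (lambda_real (2 * j))"
      using j by (intro dirichlet_lambda_of_nat) auto
    ultimately show "(-1) ^ j * 2 ^ (2 * j) * of_real (lambda_real (2 * j)) /
        (fact (2 * (m - j) + 1) * of_real pi ^ (2 * j)) =
      (-1) ^ j * 2 ^ (2 * j) * dirichlet_lambda (of_nat (2 * j)) /
        (Gamma (of_nat (2 * l - 2 * j)) * of_real pi ^ (2 * j))"
      by simp
  qed
  also have "fact (2 * m) = Gamma (of_nat (2 * l - 1) :: complex)"
    using Gamma_of_nat_Suc[of "2 * m"] by (simp add: l)
  finally show ?thesis
    by (simp add: l)
qed

lemma zeta_summand_eq:
  assumes "j \<in> {1..l - 1}"
  shows "(-1) ^ j * 2 ^ (2 * j) * dirichlet_lambda (of_nat (2 * j)) /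
           (Gamma (of_nat (2 * l - 2 * j)) * of_real pi ^ (2 * j)) =
         (-1) ^ j * (2 ^ (2 * j) - 1) * zeta (of_nat (2 * j)) /
           (Gamma (of_nat (2 * l - 2 * j)) * of_real pi ^ (2 * j))"
proof -
  have "2 ^ (2 * j) * dirichlet_lambda (of_nat (2 * j)) = (2 ^ (2 * j) - 1) * zeta (of_nat (2 * j))"
    using assms by (intro dirichlet_lambda_eq_zeta) auto
  then show ?thesis
    by (simp only: mult.assoc)
qed

text \<open>The negative of \<open>tanh_coeff_eq\<close>, carried over to the complex numbers and
  divided by \<Gamma>(2l-2j).\<close>

lemma bernoulli_summand_eq:
  assumes "j \<in> {1..l - 1}"
  shows "2 * ((-1) ^ j * 2 ^ (2 * j) * dirichlet_lambda (of_nat (2 * j)) /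
           (Gamma (of_nat (2 * l - 2 * j)) * of_real pi ^ (2 * j))) =
         - (2 ^ (2 * j) * (2 ^ (2 * j) - 1) * of_real (bernoulli (2 * j)) /
           (Gamma (of_nat (2 * l - 2 * j)) * Gamma (of_nat (2 * j + 1))))"
proof -
  have G: "Gamma (of_nat (2 * j + 1) :: complex) = fact (2 * j)"
    using Gamma_of_nat_Suc[of "2 * j"] by simp
  have L: "dirichlet_lambda (of_nat (2 * j)) = of_real (lambda_real (2 * j))"
    using assms by (intro dirichlet_lambda_of_nat) auto
  have "2 * ((-1) ^ j * 2 ^ (2 * j) * lambda_real (2 * j) / pi ^ (2 * j))
      = - (2 ^ (2 * j) * (2 ^ (2 * j) - 1) * bernoulli (2 * j) / fact (2 * j))"
    using tanh_coeff_eq[of j] assms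
    by (simp add: tanh_coeff_lambda_def tanh_coeff_bernoulli_def power_divide mult_ac)
  then have "complex_of_real (2 * ((-1) ^ j * 2 ^ (2 * j) * lambda_real (2 * j) / pi ^ (2 * j)))
      = of_real (- (2 ^ (2 * j) * (2 ^ (2 * j) - 1) * bernoulli (2 * j) / fact (2 * j)))"
    by (simp only:)
  then have "2 * ((-1) ^ j * 2 ^ (2 * j) * of_real (lambda_real (2 * j)) / complex_of_real pi ^ (2 * j))
      = - (2 ^ (2 * j) * (2 ^ (2 * j) - 1) * of_real (bernoulli (2 * j)) / fact (2 * j))"
    by simp
  from arg_cong[OF this, of "\<lambda>z. z / Gamma (of_nat (2 * l - 2 * j))"]
  show ?thesis
    unfolding G L by (simp only: times_divide_eq_right divide_divide_eq_left minus_divide_left mult_ac)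
qed

theorem mainTheorem1:
  shows "dirichlet_beta 1 = of_real (pi / 4) \<and>
    dirichlet_beta 3 = of_real (pi ^ 3 / 32) \<and>
    dirichlet_beta 5 = of_real (5 * pi ^ 5 / 1536) \<and>
    (\<forall>l::nat. l \<ge> 1 \<longrightarrow>
      dirichlet_beta (of_nat (2 * l - 1)) =
        (-1) ^ (l + 1) * of_real pi ^ (2 * l - 1) / 2 ^ (2 * l) *
          (1 / Gamma (of_nat (2 * l - 1)) +
           2 * (\<Sum>j = 1..l - 1. (-1) ^ j * 2 ^ (2 * j) * dirichlet_lambda (of_nat (2 * j)) /
                  (Gamma (of_nat (2 * l - 2 * j)) * of_real pi ^ (2 * j)))) \<and>
      dirichlet_beta (of_nat (2 * l - 1)) =
        (-1) ^ (l + 1) * of_real pi ^ (2 * l - 1) / 2 ^ (2 * l) *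
          (1 / Gamma (of_nat (2 * l - 1)) +
           2 * (\<Sum>j = 1..l - 1. (-1) ^ j * (2 ^ (2 * j) - 1) * zeta (of_nat (2 * j)) /
                  (Gamma (of_nat (2 * l - 2 * j)) * of_real pi ^ (2 * j)))) \<and>
      dirichlet_beta (of_nat (2 * l - 1)) =
        (-1) ^ (l + 1) * of_real pi ^ (2 * l - 1) / 2 ^ (2 * l) *
          (1 / Gamma (of_nat (2 * l - 1)) -
           (\<Sum>j = 1..l - 1. 2 ^ (2 * j) * (2 ^ (2 * j) - 1) * of_real (bernoulli (2 * j)) /
                  (Gamma (of_nat (2 * l - 2 * j)) * Gamma (of_nat (2 * j + 1))))))"
proof (intro conjI allI impI)
  show "dirichlet_beta 1 = of_real (pi / 4)"
    using dirichlet_beta_of_nat[of 1] suminf_beta_eq_poly[of 0]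
    by (simp add: odd_sin_poly_def del: of_real_divide)
  show "dirichlet_beta 3 = of_real (pi ^ 3 / 32)"
    unfolding suminf_beta_3[symmetric] using dirichlet_beta_of_nat[of 3] by simp
  show "dirichlet_beta 5 = of_real (5 * pi ^ 5 / 1536)"
    unfolding suminf_beta_5[symmetric] using dirichlet_beta_of_nat[of 5] by simp
next
  fix l :: nat assume l: "l \<ge> 1"
  note beta = dirichlet_beta_eq_lambda_sum[OF l]
  have zeta_sum: "(\<Sum>j = 1..l - 1. (-1) ^ j * 2 ^ (2 * j) * dirichlet_lambda (of_nat (2 * j)) /
          (Gamma (of_nat (2 * l - 2 * j)) * of_real pi ^ (2 * j))) =
      (\<Sum>j = 1..l - 1. (-1) ^ j * (2 ^ (2 * j) - 1) * zeta (of_nat (2 * j)) /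
          (Gamma (of_nat (2 * l - 2 * j)) * of_real pi ^ (2 * j)))"
    by (rule sum.cong[OF refl zeta_summand_eq])
  have bernoulli_sum: "2 * (\<Sum>j = 1..l - 1. (-1) ^ j * 2 ^ (2 * j) * dirichlet_lambda (of_nat (2 * j)) /
          (Gamma (of_nat (2 * l - 2 * j)) * of_real pi ^ (2 * j))) =
      - (\<Sum>j = 1..l - 1. 2 ^ (2 * j) * (2 ^ (2 * j) - 1) * of_real (bernoulli (2 * j)) /
          (Gamma (of_nat (2 * l - 2 * j)) * Gamma (of_nat (2 * j + 1))))"
    unfolding sum_distrib_left sum_negf[symmetric]
    by (rule sum.cong[OF refl bernoulli_summand_eq])
  show "dirichlet_beta (of_nat (2 * l - 1)) =
        (-1) ^ (l + 1) * of_real pi ^ (2 * l - 1) / 2 ^ (2 * l) *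
          (1 / Gamma (of_nat (2 * l - 1)) +
           2 * (\<Sum>j = 1..l - 1. (-1) ^ j * 2 ^ (2 * j) * dirichlet_lambda (of_nat (2 * j)) /
                  (Gamma (of_nat (2 * l - 2 * j)) * of_real pi ^ (2 * j))))"
    by (rule beta)
  show "dirichlet_beta (of_nat (2 * l - 1)) =
        (-1) ^ (l + 1) * of_real pi ^ (2 * l - 1) / 2 ^ (2 * l) *
          (1 / Gamma (of_nat (2 * l - 1)) +
           2 * (\<Sum>j = 1..l - 1. (-1) ^ j * (2 ^ (2 * j) - 1) * zeta (of_nat (2 * j)) /
                  (Gamma (of_nat (2 * l - 2 * j)) * of_real pi ^ (2 * j))))"
    unfolding beta zeta_sum ..
  show "dirichlet_beta (of_nat (2 * l - 1)) =
        (-1) ^ (l + 1) * of_real pi ^ (2 * l - 1) / 2 ^ (2 * l) *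
          (1 / Gamma (of_nat (2 * l - 1)) -
           (\<Sum>j = 1..l - 1. 2 ^ (2 * j) * (2 ^ (2 * j) - 1) * of_real (bernoulli (2 * j)) /
                  (Gamma (of_nat (2 * l - 2 * j)) * Gamma (of_nat (2 * j + 1)))))"
    unfolding beta bernoulli_sum by (simp only: add_uminus_conv_diff)
qed

end
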